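(* Let $G$ be a connected graph on $n\ge 2$ vertices with edge-connectivity $k$. Let $e_1,\dots,e_k$ be $k$ edges of $G$ such that removing all of them from $G$ yields a disconnected graph (such edges exist by the definition of $k$). Put $G_0=G$ and, for $s\in\{1,\dots,k\}$, let $G_{-s}$ be the graph obtained from $G$ by deleting the edges $e_1,\dots,e_s$; thus $G_{-k}$ is disconnected. Then $$b(G)=\frac{nk}{2(n-1)}$$ if and only if there exists a vertex $v$ such that (a) $v$ is an isolated vertex of $G_{-k}$, and $G$ is obtained from $G_{-k}$ by adding the $k$ edges $e_1,\dots,e_k$ all at $v$ (that is, each $e_i$ is incident with $v$), and (b) $\{v\}$ induces a sparsest cut in each of the graphs $G_{-k+i}$, $i\in\{1,2,\dots,k\}$.
   Context: Graphs are finite, simple, undirected and unweighted. For a graph $G$ with vertex set $V(G)$, $|V(G)|=n\ge 2$, and edge set $E(G)$, the $\ell_1$-Fiedler value is $$b(G)=\min\Big\{\sum_{uv\in E(G)}|x_u-x_v| : x\in\mathbb{R}^{V(G)},\ \sum_{v\in V(G)}x_v=0,\ \sum_{v\in V(G)}|x_v|=1\Big\}.$$ The edge-connectivity of $G$ is the minimum number of edges whose removal disconnects $G$. For nonempty $S\subsetneq V(G)$, $S^c=V(G)\setminus S$, let $\partial S=\{uv\in E(G):u\in S,\ v\in S^c\}$ and $\rho(S)=\frac{|\partial S|}{|S||S^c|}$. The set $S$ induces a sparsest cut in $G$ if it minimizes $\rho$ over all nonempty proper subsets of $V(G)$. *)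

theory Defs
  imports Complex_Main
begin

text \<open>
  A graph is given by its vertex set \<open>V\<close> and its edge set \<open>E\<close>, an undirected edge \<open>uv\<close> being
  the two-element set \<open>{u, v}\<close>.
\<close>

definition simple_graph :: "'a set \<Rightarrow> 'a set set \<Rightarrow> bool" where
  "simple_graph V E \<longleftrightarrow> finite V \<and> (\<forall>f\<in>E. f \<subseteq> V \<and> card f = 2)"

definition graph_connected :: "'a set \<Rightarrow> 'a set set \<Rightarrow> bool" where
  "graph_connected V E \<longleftrightarrow> V \<noteq> {} \<and> (\<forall>u\<in>V. \<forall>v\<in>V. (u, v) \<in> {(a, b). {a, b} \<in> E}\<^sup>*)"

definition edge_connectivity :: "'a set \<Rightarrow> 'a set set \<Rightarrow> nat" where
  "edge_connectivity V E =
     (LEAST k. \<exists>F. F \<subseteq> E \<and> card F = k \<and> \<not> graph_connected V (E - F))"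

definition isolated_vertex :: "'a set \<Rightarrow> 'a set set \<Rightarrow> 'a \<Rightarrow> bool" where
  "isolated_vertex V E v \<longleftrightarrow> v \<in> V \<and> (\<forall>f\<in>E. v \<notin> f)"

text \<open>The quantity \<open>\<bar>x u - x v\<bar>\<close> as a function of the unordered edge \<open>{u, v}\<close>.\<close>

definition edge_diff :: "('a \<Rightarrow> real) \<Rightarrow> 'a set \<Rightarrow> real" where
  "edge_diff x f = (THE d. \<exists>u v. f = {u, v} \<and> d = \<bar>x u - x v\<bar>)"

lemma edge_diff_pair: "edge_diff x {u, v} = \<bar>x u - x v\<bar>"
  unfolding edge_diff_def by (rule the_equality) (auto simp: doubleton_eq_iff)

text \<open>
  A vector indexed by \<open>V\<close> is represented by a function on the whole type; its values outside
  \<open>V\<close> enter neither the constraints nor the objective.  \<open>LEAST\<close> denotes the minimum (not just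
  the infimum) of the set of objective values.
\<close>

definition l1_fiedler :: "'a set \<Rightarrow> 'a set set \<Rightarrow> real" where
  "l1_fiedler V E =
     (LEAST b. \<exists>x :: 'a \<Rightarrow> real. (\<Sum>v\<in>V. x v) = 0 \<and> (\<Sum>v\<in>V. \<bar>x v\<bar>) = 1 \<and>
        b = (\<Sum>f\<in>E. edge_diff x f))"

definition edge_boundary :: "'a set \<Rightarrow> 'a set set \<Rightarrow> 'a set \<Rightarrow> 'a set set" where
  "edge_boundary V E S = {f \<in> E. \<exists>u\<in>S. \<exists>v\<in>V - S. f = {u, v}}"

definition cut_sparsity :: "'a set \<Rightarrow> 'a set set \<Rightarrow> 'a set \<Rightarrow> real" where
  "cut_sparsity V E S =
     real (card (edge_boundary V E S)) / (real (card S) * real (card (V - S)))"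

definition sparsest_cut :: "'a set \<Rightarrow> 'a set set \<Rightarrow> 'a set \<Rightarrow> bool" where
  "sparsest_cut V E S \<longleftrightarrow> is_arg_min (cut_sparsity V E) (\<lambda>T. T \<noteq> {} \<and> T \<subset> V) S"

text \<open>The edge set of \<open>G\<^bsub>-s\<^esub>\<close>, where \<open>e 1, e 2, \<dots>\<close> are the edges deleted in turn.\<close>

definition delete_first :: "'a set set \<Rightarrow> (nat \<Rightarrow> 'a set) \<Rightarrow> nat \<Rightarrow> 'a set set" where
  "delete_first E e s = E - e ` {1..s}"

end

theory Submission
  imports Defs
begin

text \<open>
  Decomposing a vector into its level sets (a discrete coarea formula) shows that
  \<open>\<Sum>\<^bsub>uv\<in>E\<^esub> \<bar>x\<^sub>u - x\<^sub>v\<bar> \<ge> r \<cdot> \<onehalf> \<Sum>\<^bsub>u,v\<in>V\<^esub> \<bar>x\<^sub>u - x\<^sub>v\<bar>\<close>, where \<open>r\<close> is the least cut sparsity, and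
  for \<open>x\<close> with zero sum the double sum is at least \<open>n \<Sum> \<bar>x\<^sub>u\<bar>\<close>.  Scaled indicator vectors give
  equality, so \<open>b(G) = n r / 2\<close>.  The deleted edges \<open>e\<^sub>1, \<dots>, e\<^sub>k\<close> form the boundary of some \<open>S\<close>,
  so \<open>r \<le> k / (\<bar>S\<bar> \<bar>S\<^sup>c\<bar>) \<le> k / (n - 1)\<close>, and \<open>r = k / (n - 1)\<close> forces \<open>S\<close> or its complement
  to be a single vertex.  Deleting \<open>s\<close> edges at that vertex lowers its own sparsity by
  \<open>s / (n - 1)\<close>, and that of any other cut by at most this amount.
\<close>

section \<open>Edge sums as sums over ordered pairs, and a discrete coarea inequality\<close>

lemma sum_edges_double:
  fixes h :: "'a set \<Rightarrow> real"
  assumes "simple_graph V E"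
  shows "(\<Sum>u\<in>V. \<Sum>v\<in>V. of_bool ({u, v} \<in> E) * h {u, v}) = 2 * (\<Sum>f\<in>E. h f)"
proof -
  have fV: "finite V" and E: "\<And>f. f \<in> E \<Longrightarrow> f \<subseteq> V \<and> card f = 2"
    using assms by (auto simp: simple_graph_def)
  have fE: "finite E"
    by (rule finite_subset[of _ "Pow V"]) (use fV E in auto)
  let ?g = "\<lambda>p. {fst p, snd p}"
  let ?A = "{p \<in> V \<times> V. ?g p \<in> E}"
  have "(\<Sum>u\<in>V. \<Sum>v\<in>V. of_bool ({u, v} \<in> E) * h {u, v})
      = (\<Sum>p\<in>V \<times> V. of_bool (?g p \<in> E) * h (?g p))"
    by (simp add: sum.cartesian_product case_prod_beta)
  also have "\<dots> = (\<Sum>p\<in>?A. h (?g p))"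
    by (rule sum.mono_neutral_cong_right) (use fV in auto)
  \<comment> \<open>Ordered pairs are grouped by their underlying edge; since edges have two
    distinct ends, each fibre consists of exactly the two orientations.\<close>
  also have "\<dots> = (\<Sum>f\<in>E. \<Sum>p\<in>{p \<in> ?A. ?g p = f}. h (?g p))"
    by (rule sum.group[symmetric]) (use fV fE in auto)
  also have "\<dots> = (\<Sum>f\<in>E. 2 * h f)"
  proof (rule sum.cong[OF refl])
    fix f assume f: "f \<in> E"
    then obtain a b where ab: "f = {a, b}" "a \<noteq> b"
      using E by (meson card_2_iff)
    have "a \<in> V" "b \<in> V" "{b, a} \<in> E"
      using f E[OF f] ab by (auto simp: insert_commute)
    then have "{p \<in> ?A. ?g p = f} = {(a, b), (b, a)}"
      using f unfolding ab(1) by (auto simp: doubleton_eq_iff)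
    then show "(\<Sum>p\<in>{p \<in> ?A. ?g p = f}. h (?g p)) = 2 * h f"
      using ab by (simp add: insert_commute)
  qed
  finally show ?thesis by (simp add: sum_distrib_left)
qed

text \<open>The double sum is a nonnegative combination of the cut sums of the superlevel sets of
  \<open>x\<close>, peeled off one at a time by induction on the number of values of
  \<open>x\<close>. The weights may have either sign, so that edges and a multiple of all pairs can
  be compared in a single sum.\<close>

lemma weighted_differences_nonneg_if_cuts_nonneg:
  fixes w :: "'a \<Rightarrow> 'a \<Rightarrow> real" and x :: "'a \<Rightarrow> real"
  assumes fin: "finite V"
    and cuts: "\<And>S. S \<subseteq> V \<Longrightarrow>
      0 \<le> (\<Sum>u\<in>V. \<Sum>v\<in>V. w u v * \<bar>of_bool (u \<in> S) - of_bool (v \<in> S)\<bar>)"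
  shows "0 \<le> (\<Sum>u\<in>V. \<Sum>v\<in>V. w u v * \<bar>x u - x v\<bar>)"
proof (induction "card (x ` V)" arbitrary: x rule: less_induct)
  case less
  show ?case
  proof (cases "\<exists>c. x ` V \<subseteq> {c}")
    case True
    then obtain c where "x ` V \<subseteq> {c}" by blast
    then have "\<And>u. u \<in> V \<Longrightarrow> x u = c" by blast
    then show ?thesis by simp
  next
    case False
    define M where "M = Max (x ` V)"
    define M' where "M' = Max (x ` V - {M})"
    define S where "S = {u \<in> V. x u = M}"
    \<comment> \<open>Truncation at the second largest value \<open>M'\<close> merges the top level
      set \<open>S\<close> with the next one, so \<open>y\<close> takes one value fewer than
      \<open>x\<close>.\<close>
    define y where "y u = min (x u) M'" for u
    have fx: "finite (x ` V)" using fin by simp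
    have M: "M \<in> x ` V" unfolding M_def using False fx by (intro Max_in) auto
    have M': "M' \<in> x ` V - {M}" unfolding M'_def using False fx by (intro Max_in) auto
    have leM: "x u \<le> M" if "u \<in> V" for u
      unfolding M_def using that fx by simp
    have leM': "x u \<le> M'" if "u \<in> V" "x u \<noteq> M" for u
      unfolding M'_def using that fx by simp
    have lt: "M' < M" using M' leM by force
    have y: "y u = (if u \<in> S then M' else x u)" if "u \<in> V" for u
      using that leM' lt by (auto simp: y_def S_def)
    have "y ` V \<subseteq> x ` V - {M}"
      using y M' by (auto simp: S_def)
    then have "card (y ` V) < card (x ` V)"
      using M fx by (intro psubset_card_mono) auto
    from less[OF this] have IH: "0 \<le> (\<Sum>u\<in>V. \<Sum>v\<in>V. w u v * \<bar>y u - y v\<bar>)" .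
    \<comment> \<open>If only \<open>u\<close> lies in \<open>S\<close>, then
      \<open>x v \<le> M' < M\<close>, so the distance from \<open>x v\<close> up to
      \<open>M\<close> breaks at \<open>M'\<close> without loss.\<close>
    have split: "\<bar>x u - x v\<bar>
        = \<bar>y u - y v\<bar> + (M - M') * \<bar>of_bool (u \<in> S) - of_bool (v \<in> S)\<bar>"
      if "u \<in> V" "v \<in> V" for u v
      using that y[of u] y[of v] lt leM'[of u] leM'[of v] by (auto simp: S_def)
    have "(\<Sum>u\<in>V. \<Sum>v\<in>V. w u v * \<bar>x u - x v\<bar>)
        = (\<Sum>u\<in>V. \<Sum>v\<in>V. w u v * \<bar>y u - y v\<bar>
            + (M - M') * (w u v * \<bar>of_bool (u \<in> S) - of_bool (v \<in> S)\<bar>))"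
      by (intro sum.cong refl) (simp add: split algebra_simps)
    also have "\<dots> = (\<Sum>u\<in>V. \<Sum>v\<in>V. w u v * \<bar>y u - y v\<bar>)
        + (M - M') * (\<Sum>u\<in>V. \<Sum>v\<in>V. w u v * \<bar>of_bool (u \<in> S) - of_bool (v \<in> S)\<bar>)"
      by (simp add: sum.distrib sum_distrib_left)
    also have "\<dots> \<ge> 0"
      using IH cuts[of S] lt by (auto simp: S_def)
    finally show ?thesis .
  qed
qed

lemma sum_abs_diff_indicator:
  assumes "finite V" "S \<subseteq> V"
  shows "(\<Sum>u\<in>V. \<Sum>v\<in>V. \<bar>of_bool (u \<in> S) - of_bool (v \<in> S) :: real\<bar>)
    = 2 * (real (card S) * real (card (V - S)))"
proof -
  have *: "V \<inter> {v. v \<in> S} = S" "V \<inter> {v. v \<notin> S} = V - S" using assms by auto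
  have "(\<Sum>u\<in>V. \<Sum>v\<in>V. \<bar>of_bool (u \<in> S) - of_bool (v \<in> S) :: real\<bar>)
     = (\<Sum>u\<in>V. \<Sum>v\<in>V. of_bool (u \<in> S) * of_bool (v \<notin> S) + of_bool (u \<notin> S) * of_bool (v \<in> S))"
    by (intro sum.cong refl) auto
  also have "\<dots> = (\<Sum>u\<in>V. of_bool (u \<in> S) * real (card (V - S))
      + of_bool (u \<notin> S) * real (card S))"
    using assms(1) * by (simp add: sum.distrib flip: sum_distrib_left)
  also have "\<dots> = 2 * (real (card S) * real (card (V - S)))"
    using assms(1) * by (simp add: sum.distrib flip: sum_distrib_right)
  finally show ?thesis .
qed

lemma edge_diff_two_valued:
  assumes "simple_graph V E" "S \<subseteq> V" "f \<in> E"
  shows "edge_diff (\<lambda>u. if u \<in> S then a else b) f = \<bar>a - b\<bar> * of_bool (f \<in> edge_boundary V E S)"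
proof -
  obtain p q where pq: "f = {p, q}" "p \<in> V" "q \<in> V"
    using assms by (force simp: simple_graph_def card_2_iff)
  show ?thesis
    using assms(2,3) pq unfolding pq(1) edge_diff_pair
    by (auto simp: edge_boundary_def doubleton_eq_iff)
qed

text \<open>The two values are left free to cover both uses: \<open>1\<close> and \<open>0\<close>
  for the indicator in the coarea argument, and the scaled values of the vector that attains the
  minimum.\<close>

lemma sum_edge_diff_two_valued:
  assumes "simple_graph V E" "S \<subseteq> V"
  shows "(\<Sum>f\<in>E. edge_diff (\<lambda>u. if u \<in> S then a else b) f)
    = \<bar>a - b\<bar> * real (card (edge_boundary V E S))"
proof -
  have "finite E"
    by (rule finite_subset[of _ "Pow V"]) (use assms in \<open>auto simp: simple_graph_def\<close>)
  moreover have "E \<inter> {f. f \<in> edge_boundary V E S} = edge_boundary V E S"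
    by (auto simp: edge_boundary_def)
  ultimately show ?thesis
    using edge_diff_two_valued[OF assms] by (simp flip: sum_distrib_left)
qed

lemma sum_edge_diff_lower_bound:
  assumes G: "simple_graph V E"
    and r: "\<And>S. S \<noteq> {} \<Longrightarrow> S \<subset> V \<Longrightarrow> r \<le> cut_sparsity V E S"
    and r0: "0 \<le> r"
    and x0: "(\<Sum>v\<in>V. x v) = 0"
  shows "r * real (card V) / 2 * (\<Sum>v\<in>V. \<bar>x v\<bar>) \<le> (\<Sum>f\<in>E. edge_diff x f)"
proof -
  have fV: "finite V" using G by (simp add: simple_graph_def)
  \<comment> \<open>For this weight the cut sum of \<open>S\<close> is twice the boundary size minus
    \<open>r * card S * card (V - S)\<close>, so its nonnegativity is the sparsity bound
    \<open>r\<close>.\<close>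
  let ?w = "\<lambda>u v. of_bool ({u, v} \<in> E) - r"
  have W: "(\<Sum>u\<in>V. \<Sum>v\<in>V. ?w u v * \<bar>z u - z v\<bar>)
      = 2 * (\<Sum>f\<in>E. edge_diff z f) - r * (\<Sum>u\<in>V. \<Sum>v\<in>V. \<bar>z u - z v\<bar>)" for z :: "'a \<Rightarrow> real"
    using sum_edges_double[OF G, of "edge_diff z"]
    by (simp add: edge_diff_pair left_diff_distrib sum_subtractf sum_distrib_left)
  have "0 \<le> (\<Sum>u\<in>V. \<Sum>v\<in>V. ?w u v * \<bar>x u - x v\<bar>)"
  proof (rule weighted_differences_nonneg_if_cuts_nonneg[OF fV])
    fix S assume S: "S \<subseteq> V"
    have ind: "(\<lambda>u. if u \<in> S then 1 else 0) = (\<lambda>u. of_bool (u \<in> S) :: real)" by auto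
    have eq: "(\<Sum>u\<in>V. \<Sum>v\<in>V. ?w u v * \<bar>of_bool (u \<in> S) - of_bool (v \<in> S)\<bar>)
       = 2 * real (card (edge_boundary V E S)) - r * (2 * (real (card S) * real (card (V - S))))"
      using sum_edge_diff_two_valued[OF G S, of 1 0]
      by (subst W) (simp add: sum_abs_diff_indicator[OF fV S] ind)
    have "r * (real (card S) * real (card (V - S))) \<le> real (card (edge_boundary V E S))"
    proof (cases "S = {} \<or> S = V")
      case False
      then have "V - S \<noteq> {}" using S by blast
      then have "0 < real (card S) * real (card (V - S))"
        using False S fV finite_subset[OF S fV] by (simp add: card_gt_0_iff)
      with False show ?thesis
        using r[of S] S by (auto simp: cut_sparsity_def pos_le_divide_eq)
    qed auto
    then show "0 \<le> (\<Sum>u\<in>V. \<Sum>v\<in>V. ?w u v * \<bar>of_bool (u \<in> S) - of_bool (v \<in> S)\<bar>)"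
      unfolding eq by simp
  qed
  then have 1: "r * (\<Sum>u\<in>V. \<Sum>v\<in>V. \<bar>x u - x v\<bar>) \<le> 2 * (\<Sum>f\<in>E. edge_diff x f)"
    unfolding W by simp
  \<comment> \<open>Because \<open>x\<close> sums to zero, the differences \<open>x u - x v\<close>
    over all \<open>v\<close> add up to \<open>card V * x u\<close>; the triangle inequality does
    the rest.\<close>
  have "real (card V) * \<bar>x u\<bar> \<le> (\<Sum>v\<in>V. \<bar>x u - x v\<bar>)" for u
  proof -
    have "real (card V) * \<bar>x u\<bar> = \<bar>\<Sum>v\<in>V. x u - x v\<bar>"
      by (simp add: sum_subtractf x0 abs_mult)
    then show ?thesis by (metis sum_abs)
  qed
  then have "real (card V) * (\<Sum>v\<in>V. \<bar>x v\<bar>) \<le> (\<Sum>u\<in>V. \<Sum>v\<in>V. \<bar>x u - x v\<bar>)"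
    by (simp add: sum_distrib_left sum_mono)
  from mult_left_mono[OF this r0] 1 show ?thesis by (simp add: algebra_simps)
qed

section \<open>The minimum over vectors expressed through a sparsest cut\<close>

lemma l1_fiedler_eq_sparsest_cut:
  assumes G: "simple_graph V E" and S: "sparsest_cut V E S"
  shows "l1_fiedler V E = real (card V) / 2 * cut_sparsity V E S"
  unfolding l1_fiedler_def
proof (rule Least_equality)
  have fV: "finite V" using G by (simp add: simple_graph_def)
  have SV: "S \<noteq> {}" "S \<subseteq> V" "V - S \<noteq> {}"
    and min: "\<And>T. T \<noteq> {} \<Longrightarrow> T \<subset> V \<Longrightarrow> cut_sparsity V E S \<le> cut_sparsity V E T"
    using S by (auto simp: sparsest_cut_def is_arg_min_linorder)
  define a b where "a = real (card S)" and "b = real (card (V - S))"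
  have pos: "a > 0" "b > 0"
    using SV fV finite_subset[OF SV(2) fV] by (auto simp: a_def b_def card_gt_0_iff)
  have ab: "a + b = real (card V)"
    using SV fV by (simp add: a_def b_def card_Diff_subset finite_subset card_mono)
  \<comment> \<open>Zero sum and unit norm force each side to carry half of the norm, with opposite
    signs. The jump \<open>1 / (2 * a) + 1 / (2 * b)\<close> equals
    \<open>(a + b) / (2 * a * b)\<close>, which turns the boundary size into
    \<open>card V / 2\<close> times the sparsity.\<close>
  let ?x = "\<lambda>u. if u \<in> S then 1 / (2 * a) else - 1 / (2 * b)"
  have *: "V \<inter> S = S" "V \<inter> - S = V - S" using SV by auto
  have "(\<Sum>v\<in>V. ?x v) = 0"
    using pos fV by (simp add: sum.If_cases * flip: a_def b_def)
  moreover have "(\<Sum>v\<in>V. \<bar>?x v\<bar>) = 1"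
  proof -
    have "(\<Sum>v\<in>V. \<bar>?x v\<bar>) = (\<Sum>v\<in>V. if v \<in> S then 1 / (2 * a) else 1 / (2 * b))"
      using pos by (intro sum.cong) auto
    also have "\<dots> = 1"
      using pos fV by (simp add: sum.If_cases * flip: a_def b_def)
    finally show ?thesis .
  qed
  moreover have "real (card V) / 2 * cut_sparsity V E S = (\<Sum>f\<in>E. edge_diff ?x f)"
    using pos unfolding sum_edge_diff_two_valued[OF G SV(2)]
    by (simp add: cut_sparsity_def field_simps flip: a_def b_def ab)
  ultimately show "\<exists>x. (\<Sum>v\<in>V. x v) = 0 \<and> (\<Sum>v\<in>V. \<bar>x v\<bar>) = 1 \<and>
      real (card V) / 2 * cut_sparsity V E S = (\<Sum>f\<in>E. edge_diff x f)"
    by blast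
  fix c
  assume "\<exists>x. (\<Sum>v\<in>V. x v) = 0 \<and> (\<Sum>v\<in>V. \<bar>x v\<bar>) = 1 \<and> c = (\<Sum>f\<in>E. edge_diff x f)"
  then obtain x where x: "(\<Sum>v\<in>V. x v) = 0" "(\<Sum>v\<in>V. \<bar>x v\<bar>) = 1"
    "c = (\<Sum>f\<in>E. edge_diff x f)" by blast
  show "real (card V) / 2 * cut_sparsity V E S \<le> c"
    using sum_edge_diff_lower_bound[OF G min _ x(1)] x(2,3)
    by (simp add: cut_sparsity_def mult.commute)
qed

lemma sparsest_cut_exists:
  assumes "finite V" "card V \<ge> 2"
  shows "\<exists>S. sparsest_cut V E S"
proof -
  obtain v where "v \<in> V"
    using assms(2) by fastforce
  moreover have "V \<noteq> {v}"
    using assms(2) by auto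
  ultimately have "{v} \<in> {T. T \<noteq> {} \<and> T \<subset> V}" by auto
  then show ?thesis
    using ex_is_arg_min_if_finite[of "{T. T \<noteq> {} \<and> T \<subset> V}" "cut_sparsity V E"] assms(1)
    by (auto simp: sparsest_cut_def psubset_eq)
qed

section \<open>Connectivity in terms of edge boundaries\<close>

lemma not_connected_if_empty_boundary:
  assumes "edge_boundary V E S = {}" "S \<noteq> {}" "S \<subset> V" "\<forall>f\<in>E. f \<subseteq> V"
  shows "\<not> graph_connected V E"
proof
  assume c: "graph_connected V E"
  obtain a b where ab: "a \<in> S" "b \<in> V - S" using assms by blast
  then have "(a, b) \<in> {(a, b). {a, b} \<in> E}\<^sup>*"
    using c assms(3) by (auto simp: graph_connected_def)
  then have "b \<in> S"
  \<comment> \<open>A path starting in \<open>S\<close> can never leave it, as the leaving edge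
    would belong to the boundary.\<close>
  proof (induction rule: rtrancl_induct)
    case (step y z)
    then have "{y, z} \<in> E" "z \<in> V" using assms(4) by auto
    with step.IH show ?case using assms(1) unfolding edge_boundary_def by blast
  qed (use ab in simp)
  with ab show False by blast
qed

text \<open>The set of vertices reachable from \<open>u\<close> is closed under edges, and it is
  proper when some \<open>v\<close> cannot be reached.\<close>

lemma empty_boundary_if_not_connected:
  assumes "\<not> graph_connected V E" "V \<noteq> {}"
  shows "\<exists>S. edge_boundary V E S = {} \<and> S \<noteq> {} \<and> S \<subset> V"
proof -
  let ?R = "{(a, b). {a, b} \<in> E}"
  obtain u v where uv: "u \<in> V" "v \<in> V" "(u, v) \<notin> ?R\<^sup>*"
    using assms by (auto simp: graph_connected_def)
  let ?S = "{w \<in> V. (u, w) \<in> ?R\<^sup>*}"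
  have "edge_boundary V E ?S = {}"
    by (auto simp: edge_boundary_def intro: rtrancl_into_rtrancl)
  moreover have "?S \<noteq> {}" "?S \<subset> V" using uv by auto
  ultimately show ?thesis by blast
qed

lemma edge_connectivity_le_boundary:
  assumes "simple_graph V E" "S \<noteq> {}" "S \<subset> V"
  shows "edge_connectivity V E \<le> card (edge_boundary V E S)"
  unfolding edge_connectivity_def
proof (rule Least_le, intro exI conjI)
  show "edge_boundary V E S \<subseteq> E" by (auto simp: edge_boundary_def)
  show "card (edge_boundary V E S) = card (edge_boundary V E S)" ..
  show "\<not> graph_connected V (E - edge_boundary V E S)"
    by (rule not_connected_if_empty_boundary[OF _ assms(2,3)])
       (use assms in \<open>auto simp: edge_boundary_def simple_graph_def\<close>)
qed

section \<open>Singleton cuts: the extremal product of sides and the effect of deleting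
  edges\<close>

lemma cut_sides_product_ge:
  assumes "finite V" "S \<noteq> {}" "S \<subset> V"
  shows "real (card V) - 1 \<le> real (card S) * real (card (V - S))"
    and "real (card S) * real (card (V - S)) = real (card V) - 1 \<Longrightarrow>
      card S = 1 \<or> card (V - S) = 1"
proof -
  have "finite S" using assms finite_subset by blast
  then have ge: "card S \<ge> 1" "card (V - S) \<ge> 1"
    using assms by (auto simp: Suc_le_eq card_gt_0_iff)
  have "real (card S) + real (card (V - S)) = real (card V)"
    using assms \<open>finite S\<close> by (simp add: card_Diff_subset card_mono psubset_imp_subset)
  \<comment> \<open>This factorization yields the bound, and in the equality case one of the two
    factors vanishes.\<close>
  then have eq: "real (card S) * real (card (V - S)) - (real (card V) - 1)
      = (real (card S) - 1) * (real (card (V - S)) - 1)"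
    by (simp add: algebra_simps)
  also have "\<dots> \<ge> 0" using ge by simp
  finally show "real (card V) - 1 \<le> real (card S) * real (card (V - S))" by simp
  assume "real (card S) * real (card (V - S)) = real (card V) - 1"
  then show "card S = 1 \<or> card (V - S) = 1" using eq by auto
qed

lemma edge_boundary_complement:
  assumes "S \<subseteq> V"
  shows "edge_boundary V E (V - S) = edge_boundary V E S"
  using assms by (auto simp: edge_boundary_def insert_commute)

lemma edge_boundary_singleton:
  assumes "simple_graph V E" "v \<in> V"
  shows "edge_boundary V E {v} = {f \<in> E. v \<in> f}"
proof (intro equalityI subsetI)
  fix f assume "f \<in> {f \<in> E. v \<in> f}"
  then have f: "f \<in> E" "v \<in> f" "f \<subseteq> V" "card f = 2"
    using assms(1) by (auto simp: simple_graph_def)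
  then obtain w where "f = {v, w}" "w \<noteq> v"
    by (auto simp: card_2_iff)
  then show "f \<in> edge_boundary V E {v}"
    using f by (auto simp: edge_boundary_def)
qed (auto simp: edge_boundary_def)

text \<open>Deleting \<open>F\<close> costs \<open>{v}\<close> exactly \<open>card F / N\<close> in
  sparsity, while a cut with product of sides \<open>m \<ge> N\<close> loses at most
  \<open>card F / m\<close>, so the order is preserved.\<close>

lemma sparsest_singleton_delete:
  assumes fin: "finite V" "finite E" and v: "v \<in> V" "V \<noteq> {v}"
    and F: "F \<subseteq> edge_boundary V E {v}"
    and S: "sparsest_cut V E {v}"
  shows "sparsest_cut V (E - F) {v}"
proof -
  define d where "d = real (card (edge_boundary V E {v}))"
  define N where "N = real (card V) - 1"
  have cV: "real (card (V - {v})) = N"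
    using v fin card_Suc_Diff1[of V v] by (simp add: N_def del: card_Diff_insert)
  have "V - {v} \<noteq> {}" using v by auto
  then have N: "N > 0"
    unfolding cV[symmetric] using fin by (simp add: card_gt_0_iff)
  have fF: "finite F" using F fin by (auto simp: edge_boundary_def intro: finite_subset)
  have bd: "edge_boundary V (E - F) T = edge_boundary V E T - F" for T
    by (auto simp: edge_boundary_def)
  have "cut_sparsity V (E - F) {v} \<le> cut_sparsity V (E - F) T" if T: "T \<noteq> {}" "T \<subset> V" for T
  proof -
    define m where "m = real (card T) * real (card (V - T))"
    have m: "N \<le> m" unfolding m_def N_def by (rule cut_sides_product_ge[OF fin(1) T])
    have "d / N \<le> real (card (edge_boundary V E T)) / m"
      using S T by (auto simp: sparsest_cut_def is_arg_min_linorder cut_sparsity_def cV d_def m_def)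
    \<comment> \<open>Edges of \<open>F\<close> may fail to cross \<open>T\<close>, hence an
      inequality; for \<open>{v}\<close>, whose boundary contains \<open>F\<close>, the count below
      is exact.\<close>
    moreover have "real (card (edge_boundary V E T)) - real (card F)
        \<le> real (card (edge_boundary V E T - F))"
      using diff_card_le_card_Diff[OF fF, of "edge_boundary V E T"] by linarith
    then have "real (card (edge_boundary V E T)) / m - real (card F) / m
        \<le> real (card (edge_boundary V E T - F)) / m"
      using m N by (simp add: divide_right_mono flip: diff_divide_distrib)
    moreover have "real (card F) / m \<le> real (card F) / N"
      using m N by (simp add: frac_le)
    ultimately have "(d - real (card F)) / N \<le> real (card (edge_boundary V E T - F)) / m"
      by (simp add: diff_divide_distrib)
    moreover have "real (card (edge_boundary V E {v} - F)) = d - real (card F)"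
      unfolding d_def using F fF fin
      by (simp add: card_Diff_subset of_nat_diff card_mono edge_boundary_def)
    ultimately show ?thesis by (simp add: cut_sparsity_def bd cV m_def)
  qed
  then show ?thesis
    using v by (auto simp: sparsest_cut_def is_arg_min_linorder)
qed

section \<open>The equality case, read off from the cut formed by the deleted edges\<close>

theorem theorem6p2:
  fixes V :: "'a set" and E :: "'a set set" and e :: "nat \<Rightarrow> 'a set" and n k :: nat
  assumes "simple_graph V E"
    and "n = card V" and "n \<ge> 2"
    and "graph_connected V E"
    and "k = edge_connectivity V E"
    and "inj_on e {1..k}" and "e ` {1..k} \<subseteq> E"
    and "\<not> graph_connected V (delete_first E e k)"
  shows "l1_fiedler V E = real n * real k / (2 * (real n - 1)) \<longleftrightarrow>
    (\<exists>v\<in>V. (isolated_vertex V (delete_first E e k) v \<and> (\<forall>i\<in>{1..k}. v \<in> e i)) \<and>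
           (\<forall>i\<in>{1..k}. sparsest_cut V (delete_first E e (k - i)) {v}))"
proof -
  have fV: "finite V" using assms(1) by (simp add: simple_graph_def)
  have fE: "finite E"
    by (rule finite_subset[of _ "Pow V"]) (use assms(1) in \<open>auto simp: simple_graph_def\<close>)
  have V2: "card V \<ge> 2" using assms by simp
  have Vv: "V \<noteq> {v}" for v using V2 by auto
  define K where "K = e ` {1..k}"
  have K: "K \<subseteq> E" "finite K" "card K = k"
    using assms by (auto simp: K_def card_image)
  have nc: "\<not> graph_connected V (E - K)"
    using assms(8) by (simp add: delete_first_def K_def)
  have "k \<noteq> 0"
  proof
    assume "k = 0"
    with K nc assms(4) show False by simp
  qed
  have sing: "cut_sparsity V E {v} = real k / (real n - 1)"
    if "v \<in> V" "edge_boundary V E {v} = K" for v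
    using that K fV assms(2,3) by (simp add: cut_sparsity_def of_nat_diff)
  show ?thesis
  proof
    assume b: "l1_fiedler V E = real n * real k / (2 * (real n - 1))"
    obtain S0 where S0: "sparsest_cut V E S0"
      using sparsest_cut_exists[OF fV V2] by blast
    have "real n / 2 * cut_sparsity V E S0 = real n / 2 * (real k / (real n - 1))"
      using l1_fiedler_eq_sparsest_cut[OF assms(1) S0] b assms(2) by simp
    then have r: "cut_sparsity V E S0 = real k / (real n - 1)"
      using assms(3) by (subst (asm) mult_cancel_left) auto
    have min: "real k / (real n - 1) \<le> cut_sparsity V E T" if "T \<noteq> {}" "T \<subset> V" for T
      using S0 that unfolding sparsest_cut_def is_arg_min_linorder r[symmetric] by blast
    obtain S where S: "edge_boundary V (E - K) S = {}" "S \<noteq> {}" "S \<subset> V"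
      using empty_boundary_if_not_connected[OF nc] assms(4) by (auto simp: graph_connected_def)
    have "edge_boundary V E S \<subseteq> K"
      using S(1) by (auto simp: edge_boundary_def)
    \<comment> \<open>The boundary lies inside \<open>K\<close>, and edge-connectivity gives it at
      least \<open>k = card K\<close> elements.\<close>
    then have bS: "edge_boundary V E S = K"
      using edge_connectivity_le_boundary[OF assms(1) S(2,3)] K assms(5)
      by (intro card_seteq) auto
    define m where "m = real (card S) * real (card (V - S))"
    have m: "0 < real n - 1" "real n - 1 \<le> m"
      using cut_sides_product_ge(1)[OF fV S(2,3)] assms(2,3) by (simp_all add: m_def)
    \<comment> \<open>The cut \<open>S\<close> has sparsity \<open>k / m\<close>, which cannot be
      below the minimum; as \<open>k\<close> is nonzero, this squeezes \<open>m\<close> down to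
      \<open>n - 1\<close>.\<close>
    have "real k / (real n - 1) \<le> real k / m"
      using min[OF S(2,3)] by (simp add: cut_sparsity_def bS K m_def)
    then have "real k * m \<le> real k * (real n - 1)"
      using m by (simp add: frac_le_eq field_simps)
    then have "m \<le> real n - 1"
      using \<open>k \<noteq> 0\<close> by (subst (asm) mult_le_cancel_left_pos) auto
    then have "real (card S) * real (card (V - S)) = real (card V) - 1"
      using m assms(2) by (simp add: m_def)
    then have "card S = 1 \<or> card (V - S) = 1"
      by (rule cut_sides_product_ge(2)[OF fV S(2,3)])
    then obtain v where v: "v \<in> V" "edge_boundary V E {v} = K"
    proof
      assume "card S = 1"
      then show thesis using that S(3) bS by (auto simp: card_1_singleton_iff)
    next
      assume "card (V - S) = 1"
      then obtain v where "V - S = {v}" by (auto simp: card_1_singleton_iff)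
      then show thesis
        using that[of v] edge_boundary_complement[of S V E] S(3) bS by auto
    qed
    have Kv: "K = {f \<in> E. v \<in> f}"
      using edge_boundary_singleton[OF assms(1) v(1)] v(2) by simp
    have "sparsest_cut V E {v}"
      using min v Vv sing[OF v] by (auto simp: sparsest_cut_def is_arg_min_linorder)
    \<comment> \<open>The first \<open>k - i\<close> deleted edges all belong to \<open>K\<close>,
      the boundary of \<open>{v}\<close>.\<close>
    then have "sparsest_cut V (delete_first E e (k - i)) {v}" for i
      unfolding delete_first_def
      by (intro sparsest_singleton_delete fV fE v Vv) (auto simp: v K_def)
    moreover have "isolated_vertex V (delete_first E e k) v"
      unfolding isolated_vertex_def delete_first_def K_def[symmetric] using v(1) Kv by blast
    moreover have "\<forall>i\<in>{1..k}. v \<in> e i"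
      using Kv unfolding K_def by blast
    ultimately show "\<exists>v\<in>V. (isolated_vertex V (delete_first E e k) v \<and> (\<forall>i\<in>{1..k}. v \<in> e i)) \<and>
           (\<forall>i\<in>{1..k}. sparsest_cut V (delete_first E e (k - i)) {v})"
      using v by blast
  next
    assume "\<exists>v\<in>V. (isolated_vertex V (delete_first E e k) v \<and> (\<forall>i\<in>{1..k}. v \<in> e i)) \<and>
           (\<forall>i\<in>{1..k}. sparsest_cut V (delete_first E e (k - i)) {v})"
    then obtain v where v: "v \<in> V" "isolated_vertex V (E - K) v" "\<forall>f\<in>K. v \<in> f"
      and sp: "\<forall>i\<in>{1..k}. sparsest_cut V (delete_first E e (k - i)) {v}"
      by (auto simp: delete_first_def K_def)
    have "sparsest_cut V E {v}"
      \<comment> \<open>At \<open>i = k\<close> nothing is deleted, \<open>{1..0}\<close> being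
        empty, so this instance concerns \<open>E\<close> itself; \<open>k\<close> lies in
        \<open>{1..k}\<close> because it is nonzero.\<close>
      using bspec[OF sp, of k] \<open>k \<noteq> 0\<close> by (simp add: delete_first_def)
    moreover have "edge_boundary V E {v} = K"
      using v K(1) edge_boundary_singleton[OF assms(1) v(1)]
      by (auto simp: isolated_vertex_def)
    ultimately have "l1_fiedler V E = real n / 2 * (real k / (real n - 1))"
      using l1_fiedler_eq_sparsest_cut[OF assms(1)] sing[OF v(1)] assms(2) by metis
    then show "l1_fiedler V E = real n * real k / (2 * (real n - 1))"
      by (simp only: times_divide_times_eq)
  qed
qed

end
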